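(* Fix $\rho\in\mathcal{C}_{\rm aff}$ and $P\in\mathcal{P}^\rho_d$, where $\mathcal{C}_{\rm aff}$ is the collection of power loss functions $\rho(t)=|t|^r$ with $r\geq 1$. Let $A$ be an invertible $d\times d$ matrix and $b$ be a $d$-vector. Then, for any $\alpha\in(0,1)$ and $u\in\mathcal{S}^{d-1}$, $$\pi^\rho_{\alpha,u_A}(P_{A,b})=A\,\pi^\rho_{\alpha,u}(P)+b\quad\text{and}\quad H^\rho_{\alpha,u_A}(P_{A,b})=A\,H^\rho_{\alpha,u}(P)+b,$$ where $u_A:=(A^{-1})'u/\|(A^{-1})'u\|$ and where $P_{A,b}$ is the distribution of $AZ+b$ when $Z$ is a random $d$-vector with distribution $P$.
   Context: A prime denotes transposition, $\mathbb{I}[A]$ is the indicator of $A$, and $\mathcal{S}^{d-1}=\{z\in\mathbb{R}^d:\|z\|=1\}$. For a loss function $\rho$ (convex, symmetric, nonnegative, vanishing only at $0$), $\psi_-$ denotes its left-derivative. For a probability measure $P$ over $\mathbb{R}^d$ and $u\in\mathcal{S}^{d-1}$, $P_u$ is the distribution of $u'Z$, where $Z$ has distribution $P$. $\mathcal{P}_d^\rho$ is the collection of probability measures $P$ over $\mathbb{R}^d$ such that no hyperplane of $\mathbb{R}^d$ has $P$-probability one and $\int|\psi_-(z-\theta)|\,dP_u(z)<\infty$ for any $\theta\in\mathbb{R}$ and $u\in\mathcal{S}^{d-1}$. For $P\in\mathcal{P}_d^\rho$ and $Z\sim P$, let $$G^\rho_u(\theta):=\frac{\mathrm{E}[|\psi_-(u'Z-\theta)|\,\mathbb{I}[u'Z\leq\theta]]}{\mathrm{E}[|\psi_-(u'Z-\theta)|]},\qquad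 \theta^\rho_\alpha(P_u):=\inf\{\theta\in\mathbb{R}:G_u^\rho(\theta)\geq\alpha\}$$ (the order-$\alpha$ M-quantile of $P_u$). The order-$\alpha$ M-quantile of $P$ in direction $u$ is the hyperplane $\pi^\rho_{\alpha,u}(P)=\{z\in\mathbb{R}^d:u'z=\theta^\rho_\alpha(P_u)\}$ and the corresponding M-quantile halfspace is $H^\rho_{\alpha,u}(P)=\{z\in\mathbb{R}^d:u'z\geq\theta^\rho_\alpha(P_u)\}$. *)

theory Defs
  imports "HOL-Probability.Probability"
begin

text \<open>\<open>\<bar>t\<bar> powr r\<close> is the usual power also at \<open>t = 0\<close>, since \<open>0 powr r = 0\<close> and \<open>r \<ge> 1\<close>.\<close>

definition power_losses :: "(real \<Rightarrow> real) set" where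
  "power_losses = {\<rho>. \<exists>r\<ge>1. \<rho> = (\<lambda>t. \<bar>t\<bar> powr r)}"

definition left_deriv :: "(real \<Rightarrow> real) \<Rightarrow> real \<Rightarrow> real" where
  "left_deriv \<rho> x = (THE D. (\<rho> has_real_derivative D) (at_left x))"

definition proj_distr :: "(real ^ 'd) measure \<Rightarrow> real ^ 'd \<Rightarrow> real measure" where
  "proj_distr P u = distr P borel (\<lambda>z. u \<bullet> z)"

definition mquantile_measures :: "(real \<Rightarrow> real) \<Rightarrow> (real ^ 'd) measure set" where
  "mquantile_measures \<rho> = {P. prob_space P \<and> sets P = sets borel \<and>
     (\<forall>a c. a \<noteq> 0 \<longrightarrow> measure P {z. a \<bullet> z = c} \<noteq> 1) \<and>
     (\<forall>\<theta>. \<forall>u \<in> sphere 0 1. integrable (proj_distr P u) (\<lambda>z. \<bar>left_deriv \<rho> (z - \<theta>)\<bar>))}"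

definition mquantile_G ::
  "(real \<Rightarrow> real) \<Rightarrow> (real ^ 'd) measure \<Rightarrow> real ^ 'd \<Rightarrow> real \<Rightarrow> real" where
  "mquantile_G \<rho> P u \<theta> =
     (LINT z|P. \<bar>left_deriv \<rho> (u \<bullet> z - \<theta>)\<bar> * indicator {..\<theta>} (u \<bullet> z)) /
     (LINT z|P. \<bar>left_deriv \<rho> (u \<bullet> z - \<theta>)\<bar>)"

text \<open>This is the M-quantile of the univariate measure \<open>proj_distr P u\<close>: \<open>mquantile_G\<close> depends on
  \<open>P\<close> and \<open>u\<close> only through the distribution of \<open>u \<bullet> z\<close>.\<close>

definition mquantile ::
  "(real \<Rightarrow> real) \<Rightarrow> real \<Rightarrow> real ^ 'd \<Rightarrow> (real ^ 'd) measure \<Rightarrow> real" where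
  "mquantile \<rho> \<alpha> u P = Inf {\<theta>. mquantile_G \<rho> P u \<theta> \<ge> \<alpha>}"

definition mquantile_hyperplane ::
  "(real \<Rightarrow> real) \<Rightarrow> real \<Rightarrow> real ^ 'd \<Rightarrow> (real ^ 'd) measure \<Rightarrow> (real ^ 'd) set" where
  "mquantile_hyperplane \<rho> \<alpha> u P = {z. u \<bullet> z = mquantile \<rho> \<alpha> u P}"

definition mquantile_halfspace ::
  "(real \<Rightarrow> real) \<Rightarrow> real \<Rightarrow> real ^ 'd \<Rightarrow> (real ^ 'd) measure \<Rightarrow> (real ^ 'd) set" where
  "mquantile_halfspace \<rho> \<alpha> u P = {z. u \<bullet> z \<ge> mquantile \<rho> \<alpha> u P}"

definition affine_direction :: "real ^ 'd ^ 'd \<Rightarrow> real ^ 'd \<Rightarrow> real ^ 'd" where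
  "affine_direction A u =
     (1 / norm (transpose (matrix_inv A) *v u)) *\<^sub>R (transpose (matrix_inv A) *v u)"

definition affine_distr ::
  "real ^ 'd ^ 'd \<Rightarrow> real ^ 'd \<Rightarrow> (real ^ 'd) measure \<Rightarrow> (real ^ 'd) measure" where
  "affine_distr A b P = distr P borel (\<lambda>z. A *v z + b)"

end

theory Submission
  imports Defs
begin

text \<open>Let \<open>w\<close> be the transformed direction, \<open>k = 1 / \<parallel>A\<^sup>-\<^sup>T u\<parallel>\<close> and \<open>c = w \<bullet> b\<close>. Since
  \<open>A\<^sup>-\<^sup>T u \<bullet> A z = u \<bullet> z\<close>, projecting the transformed point \<open>A z + b\<close> on \<open>w\<close> gives
  \<open>k (u \<bullet> z) + c\<close> (\<open>inner_affine_direction\<close>): along these two directions the affine map acts as an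
  increasing affine map of the line. The claim thus reduces to the univariate equivariance
  \<open>mquantile_affine\<close>, that the M-quantile of the transformed measure in direction \<open>w\<close> is \<open>k\<close> times
  the original one plus \<open>c\<close>.

  Power losses enter because the left derivative of \<open>\<bar>t\<bar> powr r\<close> is homogeneous of degree
  \<open>r - 1\<close>. Rescaling by \<open>k\<close> multiplies numerator and denominator of \<open>mquantile_G\<close> by the
  same factor \<open>k powr (r - 1)\<close>, so the level set \<open>{\<theta>. mquantile_G \<ge> \<alpha>}\<close> is mapped onto the
  corresponding level set of the transformed measure by \<open>\<theta> \<mapsto> k \<theta> + c\<close>.

  It remains to exchange this map with the infimum, which for the real-valued \<open>Inf\<close> requires a
  nonempty level set that is bounded below. Both follow from the limits 1 and 0 of
  \<open>mquantile_G\<close> at \<open>\<infinity>\<close> and \<open>-\<infinity>\<close>, obtained by dominated convergence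
  (\<open>upper_weight_share_tendsto_0\<close> and \<open>weighted_cdf_level_set\<close>).\<close>

section \<open>The left derivative of a power loss\<close>

lemma left_deriv_eq:
  assumes "(\<rho> has_real_derivative D) (at_left x)"
  shows "left_deriv \<rho> x = D"
  unfolding left_deriv_def
proof (rule the_equality, fact assms)
  fix E assume "(\<rho> has_real_derivative E) (at_left x)"
  with assms show "E = D"
    by (auto simp: has_field_derivative_iff intro: tendsto_unique[of "at_left x"])
qed

text \<open>The value at 0 distinguishes the kink of \<open>\<bar>t\<bar>\<close>, with left derivative \<open>-1\<close>, from the smooth
  minimum for \<open>r > 1\<close>. The formula \<open>r * \<bar>x\<bar> powr (r - 1)\<close> would give 0 in both cases, because
  \<open>0 powr 0 = 0\<close>.\<close>

lemma abs_left_deriv_power: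
  assumes "r \<ge> 1"
  shows "\<bar>left_deriv (\<lambda>t. \<bar>t\<bar> powr r) x\<bar> =
    (if x = 0 then if r = 1 then 1 else 0 else r * \<bar>x\<bar> powr (r - 1))"
proof (cases "x = 0")
  case True
  have negative: "\<forall>\<^sub>F y in at_left (0::real). y \<in> {- 1<..<0}"
    by (rule eventually_at_left_real) simp
  then have quotient: "\<forall>\<^sub>F y in at_left 0. - ((- y) powr (r - 1)) = \<bar>y\<bar> powr r / y"
    by eventually_elim (auto simp: powr_diff)
  have "((\<lambda>t. \<bar>t\<bar> powr r) has_real_derivative (if r = 1 then -1 else 0)) (at_left 0)"
  proof (cases "r = 1")
    case True
    have "\<forall>\<^sub>F y in at_left 0. \<bar>y\<bar> powr r / (y::real) = - 1"
      using negative by eventually_elim (auto simp: True)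
    then show ?thesis
      using True by (simp add: has_field_derivative_iff tendsto_eventually)
  next
    case False
    have "((\<lambda>y::real. - y) \<longlongrightarrow> 0) (at_left 0)"
      by (auto intro!: tendsto_eq_intros)
    then have "((\<lambda>y::real. - ((- y) powr (r - 1))) \<longlongrightarrow> - (0 powr (r - 1))) (at_left 0)"
      using False assms
      by (intro tendsto_intros tendsto_powr2)
        (auto simp: eventually_at_filter intro!: always_eventually)
    then have "((\<lambda>y::real. \<bar>y\<bar> powr r / y) \<longlongrightarrow> 0) (at_left 0)"
      using quotient by (auto intro: Lim_transform_eventually)
    then show ?thesis
      using False by (simp add: has_field_derivative_iff)
  qed
  from left_deriv_eq[OF this] show ?thesis
    using True by simp
next
  case False
  have "((\<lambda>t. sgn x * t) has_real_derivative sgn x) (at x)"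
    by (auto intro!: derivative_eq_intros)
  then have "(abs has_real_derivative sgn x) (at x)"
    by (rule has_field_derivative_transform_within_open[where S = "{t. 0 < sgn x * t}"])
       (use False in \<open>auto simp: sgn_if intro!: open_Collect_less continuous_intros split: if_splits\<close>)
  then have abs_deriv: "(abs has_real_derivative sgn x) (at_left x)"
    by (rule has_field_derivative_at_within)
  have "((\<lambda>t. \<bar>t\<bar> powr r) has_real_derivative (r * \<bar>x\<bar> powr (r - 1) * sgn x)) (at_left x)"
    using False abs_deriv by (auto intro!: derivative_eq_intros)
  from left_deriv_eq[OF this] show ?thesis
    using False assms by (simp add: abs_mult)
qed

lemma abs_left_deriv_power_scale:
  assumes "r \<ge> 1" "c > 0"
  shows "\<bar>left_deriv (\<lambda>t. \<bar>t\<bar> powr r) (c * x)\<bar> =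
    c powr (r - 1) * \<bar>left_deriv (\<lambda>t. \<bar>t\<bar> powr r) x\<bar>"
  using assms by (auto simp: abs_left_deriv_power abs_mult powr_mult)

lemma abs_left_deriv_power_mono:
  assumes "r \<ge> 1" "\<bar>x\<bar> \<le> \<bar>y\<bar>"
  shows "\<bar>left_deriv (\<lambda>t. \<bar>t\<bar> powr r) x\<bar> \<le> \<bar>left_deriv (\<lambda>t. \<bar>t\<bar> powr r) y\<bar>"
  using assms by (auto simp: abs_left_deriv_power intro!: mult_left_mono powr_mono2)

lemma measurable_abs_left_deriv_power:
  assumes "r \<ge> 1"
  shows "(\<lambda>x. \<bar>left_deriv (\<lambda>t. \<bar>t\<bar> powr r) x\<bar>) \<in> borel_measurable borel"
  unfolding abs_left_deriv_power[OF assms] by measurable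


section \<open>Limits of the weighted tail shares\<close>

lemma (in prob_space) tail_expectation_tendsto_0:
  fixes f X :: "'a \<Rightarrow> real"
  assumes f: "integrable M f" and [measurable]: "X \<in> borel_measurable M"
  shows "((\<lambda>\<theta>. expectation (\<lambda>z. f z * indicator {\<theta>..} (X z))) \<longlongrightarrow> 0) at_top"
proof -
  have [measurable]: "f \<in> borel_measurable M"
    using f by auto
  have "((\<lambda>\<theta>. expectation (\<lambda>z. f z * indicator {\<theta>..} (X z))) \<longlongrightarrow> expectation (\<lambda>z. 0)) at_top"
  proof (rule integral_dominated_convergence_at_top[where w = "\<lambda>z. \<bar>f z\<bar>"])
    show "AE z in M. ((\<lambda>\<theta>. f z * indicator {\<theta>..} (X z)) \<longlongrightarrow> 0) at_top"
    proof (rule AE_I2, rule tendsto_eventually)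
      fix z show "\<forall>\<^sub>F \<theta> in at_top. f z * indicator {\<theta>..} (X z) = 0"
        using eventually_gt_at_top[of "X z"] by eventually_elim simp
    qed
  qed (use f in \<open>auto simp: indicator_def\<close>)
  then show ?thesis by simp
qed

text \<open>For \<open>\<theta> \<ge> 0\<close>, every \<open>X \<ge> \<theta>\<close> satisfies \<open>\<bar>X - \<theta>\<bar> \<le> \<bar>X\<bar>\<close>, so the numerator is at most the tail
  expectation of the fixed integrable function \<open>h (X)\<close> and vanishes in the limit. The denominator
  stays away from 0: where \<open>X < \<theta> - 1\<close> the weight is at least \<open>h 1\<close>, and the probability of this
  event tends to 1. Stating this for any weight nondecreasing in \<open>\<bar>t\<bar>\<close> treats \<open>r = 1\<close>, where
  the weight is constant and positive at 0, together with \<open>r > 1\<close>.\<close>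

lemma (in prob_space) upper_weight_share_tendsto_0:
  fixes h :: "real \<Rightarrow> real" and X :: "'a \<Rightarrow> real"
  assumes X[measurable]: "X \<in> borel_measurable M"
    and mono: "\<And>s t. \<bar>s\<bar> \<le> \<bar>t\<bar> \<Longrightarrow> h s \<le> h t"
    and nonneg: "\<And>t. 0 \<le> h t" and pos: "0 < h 1"
    and int: "\<And>\<theta>. integrable M (\<lambda>z. h (X z - \<theta>))"
  defines "N \<equiv> \<lambda>\<theta>. expectation (\<lambda>z. h (X z - \<theta>) * indicator {\<theta>..} (X z))"
    and "D \<equiv> \<lambda>\<theta>. expectation (\<lambda>z. h (X z - \<theta>))"
  shows "((\<lambda>\<theta>. N \<theta> / D \<theta>) \<longlongrightarrow> 0) at_top" and "\<forall>\<^sub>F \<theta> in at_top. 0 < D \<theta>"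
proof -
  define U where "U \<theta> = expectation (\<lambda>z. h (X z) * indicator {\<theta>..} (X z))" for \<theta>
  define L where "L \<theta> = h 1 - expectation (\<lambda>z. h 1 * indicator {\<theta> - 1..} (X z))" for \<theta>
  have int_ind: "integrable M (\<lambda>z. h (X z - \<theta>) * indicator {\<eta>..} (X z))" for \<theta> \<eta>
    by (rule integrable_real_mult_indicator[OF _ int, of "X -` {\<eta>..} \<inter> space M",
          THEN Bochner_Integration.integrable_cong[THEN iffD1, rotated -1]])
       (auto simp: indicator_def)
  have U_lim: "(U \<longlongrightarrow> 0) at_top"
    unfolding U_def using int[of 0] by (intro tail_expectation_tendsto_0) auto
  have "filterlim (\<lambda>\<theta>::real. \<theta> - 1) at_top at_top"
    by real_asymp
  from filterlim_compose[OF tail_expectation_tendsto_0[of "\<lambda>_. h 1" X] this]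
  have "((\<lambda>\<theta>. expectation (\<lambda>z. h 1 * indicator {\<theta> - 1..} (X z))) \<longlongrightarrow> 0) at_top"
    by simp
  from tendsto_diff[OF tendsto_const this] have L_lim: "(L \<longlongrightarrow> h 1) at_top"
    unfolding L_def by simp
  have L_le_D: "L \<theta> \<le> D \<theta>" for \<theta>
  proof -
    have ind: "integrable M (\<lambda>z. h 1 * indicator {\<theta> - 1..} (X z))"
      by (rule integrable_const_bound[where B = "h 1"]) (auto simp: indicator_def nonneg)
    have "L \<theta> = expectation (\<lambda>z. h 1 - h 1 * indicator {\<theta> - 1..} (X z))"
      unfolding L_def using ind by (simp add: prob_space)
    also have "\<dots> \<le> D \<theta>"
      unfolding D_def using ind int
      by (intro integral_mono) (auto simp: indicator_def nonneg intro!: mono)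
    finally show ?thesis .
  qed
  have N_le_U: "N \<theta> \<le> U \<theta>" if "\<theta> \<ge> 0" for \<theta>
    unfolding N_def U_def using that int_ind[of \<theta>] int_ind[of 0]
    by (intro integral_mono) (auto simp: indicator_def intro!: mono)
  have L_pos: "\<forall>\<^sub>F \<theta> in at_top. 0 < L \<theta>"
    using order_tendstoD(1)[OF L_lim pos] .
  then show "\<forall>\<^sub>F \<theta> in at_top. 0 < D \<theta>"
    by eventually_elim (use L_le_D order_less_le_trans in blast)
  show "((\<lambda>\<theta>. N \<theta> / D \<theta>) \<longlongrightarrow> 0) at_top"
  proof (rule tendsto_sandwich)
    have N_nonneg: "0 \<le> N \<theta>" for \<theta>
      unfolding N_def by (auto intro!: integral_nonneg_AE simp: nonneg)
    show "\<forall>\<^sub>F \<theta> in at_top. N \<theta> / D \<theta> \<le> U \<theta> / L \<theta>"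
      using L_pos eventually_ge_at_top[of 0]
    proof eventually_elim
      case (elim \<theta>)
      with N_le_U[of \<theta>] L_le_D[of \<theta>] N_nonneg[of \<theta>] show ?case
        by (intro frac_le) auto
    qed
    show "\<forall>\<^sub>F \<theta> in at_top. 0 \<le> N \<theta> / D \<theta>"
      unfolding D_def using N_nonneg
      by (auto intro!: always_eventually divide_nonneg_nonneg integral_nonneg_AE simp: nonneg)
    show "((\<lambda>\<theta>. U \<theta> / L \<theta>) \<longlongrightarrow> 0) at_top"
      using tendsto_divide[OF U_lim L_lim] pos by simp
  qed auto
qed

text \<open>The \<open>h\<close>-weighted distribution function \<open>G\<close> tends to 1 at \<open>\<infinity>\<close>, since \<open>1 - G\<close> is at most the
  upper share of \<open>X\<close>, and to 0 at \<open>-\<infinity>\<close>, since it is the upper share of \<open>- X\<close> at the reflected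
  threshold.\<close>

lemma (in prob_space) weighted_cdf_level_set:
  fixes h :: "real \<Rightarrow> real" and X :: "'a \<Rightarrow> real"
  assumes X[measurable]: "X \<in> borel_measurable M"
    and mono: "\<And>s t. \<bar>s\<bar> \<le> \<bar>t\<bar> \<Longrightarrow> h s \<le> h t"
    and nonneg: "\<And>t. 0 \<le> h t" and pos: "0 < h 1"
    and int: "\<And>\<theta>. integrable M (\<lambda>z. h (X z - \<theta>))"
    and \<alpha>: "0 < \<alpha>" "\<alpha> < 1"
  defines "G \<equiv> \<lambda>\<theta>. expectation (\<lambda>z. h (X z - \<theta>) * indicator {..\<theta>} (X z)) /
    expectation (\<lambda>z. h (X z - \<theta>))"
  shows "{\<theta>. \<alpha> \<le> G \<theta>} \<noteq> {}" and "bdd_below {\<theta>. \<alpha> \<le> G \<theta>}"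
proof -
  have int_ind: "integrable M (\<lambda>z. h (X z - \<theta>) * indicator S (X z))"
    if [measurable]: "S \<in> sets borel" for \<theta> S
    by (rule integrable_real_mult_indicator[OF _ int, of "X -` S \<inter> space M",
          THEN Bochner_Integration.integrable_cong[THEN iffD1, rotated -1]])
       (auto simp: indicator_def)
  have upper: "((\<lambda>\<theta>. expectation (\<lambda>z. h (X z - \<theta>) * indicator {\<theta>..} (X z)) /
      expectation (\<lambda>z. h (X z - \<theta>))) \<longlongrightarrow> 0) at_top"
      "\<forall>\<^sub>F \<theta> in at_top. 0 < expectation (\<lambda>z. h (X z - \<theta>))"
    by (intro upper_weight_share_tendsto_0 X mono nonneg pos int; assumption)+
  have "0 < 1 - \<alpha>"
    using \<alpha> by simp
  from upper(2) order_tendstoD(2)[OF upper(1) this]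
  have "\<forall>\<^sub>F \<theta> in at_top. \<alpha> \<le> G \<theta>"
  proof eventually_elim
    case (elim \<theta>)
    let ?D = "expectation (\<lambda>z. h (X z - \<theta>))"
    \<comment> \<open>The two events overlap at \<open>X = \<theta>\<close>, where \<open>h 0\<close> may be positive; hence only an inequality.\<close>
    have "?D \<le> expectation (\<lambda>z. h (X z - \<theta>) * indicator {..\<theta>} (X z) +
        h (X z - \<theta>) * indicator {\<theta>..} (X z))"
      by (intro integral_mono int Bochner_Integration.integrable_add int_ind)
         (auto simp: indicator_def nonneg)
    also have "\<dots> = expectation (\<lambda>z. h (X z - \<theta>) * indicator {..\<theta>} (X z)) +
        expectation (\<lambda>z. h (X z - \<theta>) * indicator {\<theta>..} (X z))"
      by (intro Bochner_Integration.integral_add int_ind) auto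
    finally show ?case
      using elim unfolding G_def by (simp add: field_simps)
  qed
  then show "{\<theta>. \<alpha> \<le> G \<theta>} \<noteq> {}"
    using eventually_happens by fastforce
  \<comment> \<open>Monotonicity in the absolute value forces \<open>h\<close> to be even, which makes reflection possible.\<close>
  have even: "h (- t) = h t" for t
    using mono[of t "-t"] mono[of "-t" t] by simp
  have reflect: "h (- X z - \<theta>) = h (X z - - \<theta>)" for z \<theta>
    using even[of "X z + \<theta>"] by simp
  have "((\<lambda>\<theta>. expectation (\<lambda>z. h (- X z - \<theta>) * indicator {\<theta>..} (- X z)) /
    expectation (\<lambda>z. h (- X z - \<theta>))) \<longlongrightarrow> 0) at_top"
    using int by (intro upper_weight_share_tendsto_0(1) mono nonneg pos)
      (auto simp only: reflect intro!: borel_measurable_uminus X)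
  moreover have "expectation (\<lambda>z. h (- X z - \<theta>) * indicator {\<theta>..} (- X z)) /
    expectation (\<lambda>z. h (- X z - \<theta>)) = G (- \<theta>)" for \<theta>
    unfolding G_def reflect by (auto simp: indicator_def le_minus_iff)
  ultimately have "((\<lambda>\<theta>. G (- \<theta>)) \<longlongrightarrow> 0) at_top"
    by simp
  from order_tendstoD(2)[OF this \<alpha>(1)] obtain K where K: "\<And>\<theta>. \<theta> \<ge> K \<Longrightarrow> G (- \<theta>) < \<alpha>"
    by (auto simp: eventually_at_top_linorder)
  show "bdd_below {\<theta>. \<alpha> \<le> G \<theta>}"
  proof (rule bdd_belowI[of _ "- K"])
    fix \<theta> assume "\<theta> \<in> {\<theta>. \<alpha> \<le> G \<theta>}"
    with K[of "- \<theta>"] show "- K \<le> \<theta>" by force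
  qed
qed

section \<open>Affine equivariance\<close>

lemma
  assumes "invertible A"
  shows matrix_inv_left: "matrix_inv A ** A = mat 1"
    and matrix_inv_right: "A ** matrix_inv A = mat 1"
  using assms someI_ex[of "\<lambda>A'. A ** A' = mat 1 \<and> A' ** A = mat 1"]
  unfolding invertible_def matrix_inv_def by auto

lemma inner_affine_direction:
  fixes A :: "real ^ 'd ^ 'd"
  assumes "invertible A"
  shows "affine_direction A u \<bullet> (A *v z + b) =
    1 / norm (transpose (matrix_inv A) *v u) * (u \<bullet> z) + affine_direction A u \<bullet> b"
proof -
  have "(transpose (matrix_inv A) *v u) \<bullet> (A *v z) = u \<bullet> z"
    using matrix_inv_left[OF assms]
    by (simp add: transpose_matrix_vector dot_lmul_matrix matrix_vector_mul_assoc)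
  then show ?thesis
    by (simp add: affine_direction_def inner_add_right)
qed

lemma transpose_inverse_mult_nonzero:
  fixes A :: "real ^ 'd ^ 'd"
  assumes "invertible A" "u \<noteq> 0"
  shows "transpose (matrix_inv A) *v u \<noteq> 0"
proof
  assume "transpose (matrix_inv A) *v u = 0"
  then have "u \<bullet> u = 0"
    using matrix_inv_left[OF assms(1)] dot_lmul_matrix[of u "matrix_inv A" "A *v u"]
    by (simp add: transpose_matrix_vector matrix_vector_mul_assoc)
  with assms(2) show False by simp
qed

text \<open>The integrands correspond pointwise: the indicators agree since \<open>t \<mapsto> k t + c\<close> is
  increasing, and by homogeneity the weights differ by the constant factor \<open>k powr (r - 1)\<close>,
  which cancels in the quotient.\<close>

lemma mquantile_G_affine:
  fixes P :: "(real ^ 'd) measure"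
  assumes r: "r \<ge> 1" and sets: "sets P = sets borel" and k: "k > 0"
    and affine: "\<And>z. w \<bullet> (A *v z + b) = k * (u \<bullet> z) + c"
  shows "mquantile_G (\<lambda>t. \<bar>t\<bar> powr r) (affine_distr A b P) w (k * \<theta> + c) =
    mquantile_G (\<lambda>t. \<bar>t\<bar> powr r) P u \<theta>"
proof -
  note [measurable] = measurable_abs_left_deriv_power[OF r]
  have map: "(\<lambda>z. A *v z + b) \<in> P \<rightarrow>\<^sub>M borel"
    unfolding measurable_cong_sets[OF sets refl]
    by (intro borel_measurable_continuous_onI continuous_intros)
  have weight: "\<bar>left_deriv (\<lambda>t. \<bar>t\<bar> powr r) (w \<bullet> (A *v z + b) - (k * \<theta> + c))\<bar> =
      k powr (r - 1) * \<bar>left_deriv (\<lambda>t. \<bar>t\<bar> powr r) (u \<bullet> z - \<theta>)\<bar>" for z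
    using abs_left_deriv_power_scale[OF r k, of "u \<bullet> z - \<theta>"]
    unfolding affine by (simp add: right_diff_distrib)
  have event: "indicator {..k * \<theta> + c} (w \<bullet> (A *v z + b)) = (indicator {..\<theta>} (u \<bullet> z) :: real)" for z
    using k by (simp add: affine indicator_def)
  have "(LINT z|affine_distr A b P. \<bar>left_deriv (\<lambda>t. \<bar>t\<bar> powr r) (w \<bullet> z - (k * \<theta> + c))\<bar> *
        indicator {..k * \<theta> + c} (w \<bullet> z)) =
      k powr (r - 1) * (LINT z|P. \<bar>left_deriv (\<lambda>t. \<bar>t\<bar> powr r) (u \<bullet> z - \<theta>)\<bar> * indicator {..\<theta>} (u \<bullet> z))"
    unfolding affine_distr_def
    by (subst integral_distr[OF map]) (simp_all add: weight event mult.assoc)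
  moreover have "(LINT z|affine_distr A b P. \<bar>left_deriv (\<lambda>t. \<bar>t\<bar> powr r) (w \<bullet> z - (k * \<theta> + c))\<bar>) =
      k powr (r - 1) * (LINT z|P. \<bar>left_deriv (\<lambda>t. \<bar>t\<bar> powr r) (u \<bullet> z - \<theta>)\<bar>)"
    unfolding affine_distr_def
    by (subst integral_distr[OF map]) (simp_all add: weight)
  ultimately show ?thesis
    using k by (simp add: mquantile_G_def)
qed

text \<open>An increasing continuous map commutes with the infimum of a nonempty set bounded below; the
  integrability built into \<open>mquantile_measures\<close> is what makes the level set such a set.\<close>

lemma mquantile_affine:
  fixes P :: "(real ^ 'd) measure"
  assumes r: "r \<ge> 1" and P: "P \<in> mquantile_measures (\<lambda>t. \<bar>t\<bar> powr r)"
    and \<alpha>: "\<alpha> \<in> {0<..<1}" and u: "u \<in> sphere 0 1" and k: "k > 0"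
    and affine: "\<And>z. w \<bullet> (A *v z + b) = k * (u \<bullet> z) + c"
  shows "mquantile (\<lambda>t. \<bar>t\<bar> powr r) \<alpha> w (affine_distr A b P) =
    k * mquantile (\<lambda>t. \<bar>t\<bar> powr r) \<alpha> u P + c"
proof -
  define h where "h t = \<bar>left_deriv (\<lambda>t. \<bar>t\<bar> powr r) t\<bar>" for t
  have h[measurable]: "h \<in> borel_measurable borel"
    unfolding h_def by (rule measurable_abs_left_deriv_power[OF r])
  interpret prob_space P
    using P by (simp add: mquantile_measures_def)
  have sets: "sets P = sets borel"
    using P by (simp add: mquantile_measures_def)
  have proj[measurable]: "(\<lambda>z. u \<bullet> z) \<in> borel_measurable P"
    unfolding measurable_cong_sets[OF sets refl] by simp
  have int: "integrable P (\<lambda>z. h (u \<bullet> z - \<theta>))" for \<theta>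
  proof -
    have "integrable (proj_distr P u) (\<lambda>x. h (x - \<theta>))"
      using P u unfolding mquantile_measures_def h_def by blast
    then show ?thesis
      unfolding proj_distr_def by (subst (asm) integrable_distr_eq) auto
  qed
  let ?S = "{\<theta>. \<alpha> \<le> mquantile_G (\<lambda>t. \<bar>t\<bar> powr r) P u \<theta>}"
  have "?S \<noteq> {} \<and> bdd_below ?S"
    unfolding mquantile_G_def h_def[symmetric]
    using weighted_cdf_level_set[of "\<lambda>z. u \<bullet> z" h \<alpha>] proj int \<alpha>
      abs_left_deriv_power_mono[OF r] r
    by (simp add: h_def abs_left_deriv_power[of r 1])
  then have "k * Inf ?S + c = (INF \<theta>\<in>?S. k * \<theta> + c)"
    using k by (intro continuous_at_Inf_mono) (auto intro!: monoI continuous_intros)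
  also have "(\<lambda>\<theta>. k * \<theta> + c) ` ?S =
      {\<theta>. \<alpha> \<le> mquantile_G (\<lambda>t. \<bar>t\<bar> powr r) (affine_distr A b P) w \<theta>}"
  proof (intro set_eqI iffI)
    fix \<eta> assume \<eta>: "\<eta> \<in> {\<theta>. \<alpha> \<le> mquantile_G (\<lambda>t. \<bar>t\<bar> powr r) (affine_distr A b P) w \<theta>}"
    have "\<eta> = k * ((\<eta> - c) / k) + c"
      using k by simp
    with \<eta> show "\<eta> \<in> (\<lambda>\<theta>. k * \<theta> + c) ` ?S"
      using mquantile_G_affine[OF r sets k affine, of "(\<eta> - c) / k"]
      by (intro image_eqI) auto
  qed (auto simp: mquantile_G_affine[OF r sets k affine])
  finally show ?thesis
    by (simp add: mquantile_def)
qed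

theorem theorem3p1:
  fixes \<rho> :: "real \<Rightarrow> real" and P :: "(real ^ 'd) measure"
    and A :: "real ^ 'd ^ 'd" and b u :: "real ^ 'd" and \<alpha> :: real
  assumes "\<rho> \<in> power_losses" and "P \<in> mquantile_measures \<rho>"
    and "invertible A"
    and "\<alpha> \<in> {0<..<1}" and "u \<in> sphere 0 1"
  shows "mquantile_hyperplane \<rho> \<alpha> (affine_direction A u) (affine_distr A b P)
           = (\<lambda>z. A *v z + b) ` mquantile_hyperplane \<rho> \<alpha> u P
       \<and> mquantile_halfspace \<rho> \<alpha> (affine_direction A u) (affine_distr A b P)
           = (\<lambda>z. A *v z + b) ` mquantile_halfspace \<rho> \<alpha> u P"
proof -
  obtain r where r: "r \<ge> 1" and \<rho>: "\<rho> = (\<lambda>t. \<bar>t\<bar> powr r)"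
    using assms(1) by (auto simp: power_losses_def)
  define w where "w = affine_direction A u"
  define k where "k = 1 / norm (transpose (matrix_inv A) *v u)"
  define c where "c = w \<bullet> b"
  have "u \<noteq> 0"
    using assms(5) by auto
  then have k: "k > 0"
    using transpose_inverse_mult_nonzero[OF assms(3)] by (simp add: k_def)
  have affine: "w \<bullet> (A *v z + b) = k * (u \<bullet> z) + c" for z
    unfolding w_def k_def c_def by (rule inner_affine_direction[OF assms(3)])
  have q: "mquantile \<rho> \<alpha> w (affine_distr A b P) = k * mquantile \<rho> \<alpha> u P + c"
    using mquantile_affine[OF r _ assms(4,5) k affine] assms(2) by (simp add: \<rho>)
  have onto: "\<exists>z. y = A *v z + b" for y
    using matrix_inv_right[OF assms(3)]
    by (intro exI[of _ "matrix_inv A *v (y - b)"]) (simp add: matrix_vector_mul_assoc)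
  have image: "{y. R (w \<bullet> y)} = (\<lambda>z. A *v z + b) ` {z. R (k * (u \<bullet> z) + c)}" for R
    using onto affine by (auto simp: image_iff) metis
  show ?thesis
    unfolding mquantile_hyperplane_def mquantile_halfspace_def w_def[symmetric] q
    using k image[of "\<lambda>x. x = k * mquantile \<rho> \<alpha> u P + c"]
      image[of "\<lambda>x. k * mquantile \<rho> \<alpha> u P + c \<le> x"] by simp
qed

end
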